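(* Suppose that $u$ and $u_n$, $n=1,2,\ldots$, are fuzzy sets in $\widetilde{S}^m_{nc}$. Then the following statements are equivalent (all limits as $n\to\infty$). (i) $H_{\rm end}(u_n,u)\to0$. (ii) $H([u_n]_\alpha,[u]_\alpha)\to0$ holds for almost every $\alpha\in(0,1)$. (iii) $H([u_n]_\alpha,[u]_\alpha)\to0$ holds for all $\alpha\in(0,1)\setminus P(u)$. (iv) $H([u_n]_\alpha,[u]_\alpha)\to0$ holds for all $\alpha\in P$, where $P$ is some dense subset of $(0,1)\setminus P(u)$. (v) $H([u_n]_\alpha,[u]_\alpha)\to0$ holds for all $\alpha\in P$, where $P$ is some countable dense subset of $(0,1)\setminus P(u)$. (vi) $u_n$ $\Gamma$-converges to $u$. (vii) $\lim_{n\to\infty}[u_n]_\alpha\,(K)=[u]_\alpha$ for all $\alpha\in(0,1)\setminus P(u)$. (viii) $\lim_{n\to\infty}[u_n]_\alpha\,(K)=[u]_\alpha$ holds for almost every $\alpha\in(0,1)$. (ix) $\lim_{n\to\infty}[u_n]_\alpha\,(K)=[u]_\alpha$ holds for all $\alpha\in P$, where $P$ is some dense subset of $(0,1)\setminus P(u)$. (x) $\lim_{n\to\infty}[u_n]_\alpha\,(K)=[u]_\alpha$ holds for all $\alpha\in P$, where $P$ is some countable dense subset of $(0,1)\setminus P(u)$.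
   Context: A fuzzy set on $\mathbb{R}^m$ is a function $u:\mathbb{R}^m\to[0,1]$. For $\alpha\in(0,1]$, $[u]_\alpha=\{x:u(x)\ge\alpha\}$ and $\{u>\alpha\}=\{x:u(x)>\alpha\}$. $\widetilde{S}^m_{nc}$ (noncompact general fuzzy star-shaped numbers) is the set of all fuzzy sets $u$ on $\mathbb{R}^m$ such that: $u$ is upper semi-continuous; $u$ is normal, i.e. $u(x_0)=1$ for some $x_0$; for each $\lambda\in(0,1]$ there is $x_\lambda\in[u]_\lambda$ such that the line segment $\overline{x_\lambda y}$ is contained in $[u]_\lambda$ for all $y\in[u]_\lambda$; and $[u]_\alpha$ is bounded for each $\alpha\in(0,1]$. $P(u)$ is the set of platform points of $u$: those $\alpha\in(0,1)$ with $\overline{\{u>\alpha\}}\subsetneqq[u]_\alpha$. "Almost every" refers to Lebesgue measure. $H(A,B)=\max\{\sup_{a\in A}\inf_{b\in B}d(a,b),\ \sup_{b\in B}\inf_{a\in A}d(a,b)\}$ is the Hausdorff metric on nonempty closed sets ($d$ Euclidean). The endograph of $u$ is ${\rm end}\,u=\{(x,t)\in\mathbb{R}^m\times[0,1]:u(x)\ge t\}$ and $H_{\rm end}(u,v)=H({\rm end}\,u,{\rm end}\,v)$. Kuratowski convergence: $\liminf_n C_n$ is the set of $x=\lim_n x_n$ with $x_n\in C_n$, and $\limsup_n C_n$ is the set of $x=\lim_j x_{n_j}$ with $x_{n_j}\in C_{n_j}$ along some subsequence; $\lim_n C_n\,(K)=C$ means $C=\liminf_n C_n=\limsup_n C_n$.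 $u_n$ $\Gamma$-converges to $u$ if $\lim_n{\rm end}\,u_n\,(K)={\rm end}\,u$. *)

theory Defs
  imports "HOL-Analysis.Analysis"
begin

definition upper_semicontinuous :: "('a::topological_space \<Rightarrow> real) \<Rightarrow> bool" where
  "upper_semicontinuous f \<longleftrightarrow> (\<forall>x c. f x < c \<longrightarrow> (\<forall>\<^sub>F y in nhds x. f y < c))"

definition fuzzy_set :: "('a \<Rightarrow> real) \<Rightarrow> bool" where
  "fuzzy_set u \<longleftrightarrow> (\<forall>x. 0 \<le> u x \<and> u x \<le> 1)"

definition level_set :: "('a \<Rightarrow> real) \<Rightarrow> real \<Rightarrow> 'a set" where
  "level_set u \<alpha> = {x. \<alpha> \<le> u x}"

definition strict_level_set :: "('a \<Rightarrow> real) \<Rightarrow> real \<Rightarrow> 'a set" where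
  "strict_level_set u \<alpha> = {x. \<alpha> < u x}"

text \<open>Noncompact general fuzzy star-shaped numbers.  The centre of star-shapedness may depend
  on the level.\<close>

definition fuzzy_star_nc :: "((real ^ 'm) \<Rightarrow> real) set" where
  "fuzzy_star_nc = {u. fuzzy_set u \<and> upper_semicontinuous u \<and> (\<exists>x. u x = 1) \<and>
     (\<forall>\<alpha>\<in>{0<..1}. starlike (level_set u \<alpha>)) \<and>
     (\<forall>\<alpha>\<in>{0<..1}. bounded (level_set u \<alpha>))}"

definition platform_points :: "('a::topological_space \<Rightarrow> real) \<Rightarrow> real set" where
  "platform_points u = {\<alpha>\<in>{0<..<1}. closure (strict_level_set u \<alpha>) \<subset> level_set u \<alpha>}"

text \<open>The suprema are taken in \<^typ>\<open>ennreal\<close>, so that the distance of two unbounded sets may be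
  infinite instead of being an unspecified real supremum.\<close>

definition hausdorff_distance :: "'a::metric_space set \<Rightarrow> 'a set \<Rightarrow> ennreal" where
  "hausdorff_distance A B =
     max (SUP a\<in>A. INF b\<in>B. ennreal (dist a b)) (SUP b\<in>B. INF a\<in>A. ennreal (dist a b))"

definition endograph :: "('a \<Rightarrow> real) \<Rightarrow> ('a \<times> real) set" where
  "endograph u = {(x, t). 0 \<le> t \<and> t \<le> 1 \<and> t \<le> u x}"

text \<open>The distance on the product type is the Euclidean one,
  \<open>sqrt (dist x y ^ 2 + dist s t ^ 2)\<close>.\<close>

definition H_end :: "('a::metric_space \<Rightarrow> real) \<Rightarrow> ('a \<Rightarrow> real) \<Rightarrow> ennreal" where
  "H_end u v = hausdorff_distance (endograph u) (endograph v)"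

definition kuratowski_liminf :: "(nat \<Rightarrow> 'a::topological_space set) \<Rightarrow> 'a set" where
  "kuratowski_liminf C = {x. \<exists>xs. (\<forall>n. xs n \<in> C n) \<and> xs \<longlonglongrightarrow> x}"

definition kuratowski_limsup :: "(nat \<Rightarrow> 'a::topological_space set) \<Rightarrow> 'a set" where
  "kuratowski_limsup C =
     {x. \<exists>r xs. strict_mono r \<and> (\<forall>j. xs j \<in> C (r j)) \<and> xs \<longlonglongrightarrow> x}"

definition kuratowski_converges :: "(nat \<Rightarrow> 'a::topological_space set) \<Rightarrow> 'a set \<Rightarrow> bool" where
  "kuratowski_converges C L \<longleftrightarrow> L = kuratowski_liminf C \<and> L = kuratowski_limsup C"

definition Gamma_converges ::
    "(nat \<Rightarrow> 'a::topological_space \<Rightarrow> real) \<Rightarrow> ('a \<Rightarrow> real) \<Rightarrow> bool" where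
  "Gamma_converges us u \<longleftrightarrow> kuratowski_converges (\<lambda>n. endograph (us n)) (endograph u)"

definition dense_subset :: "'a::topological_space set \<Rightarrow> 'a set \<Rightarrow> bool" where
  "dense_subset P S \<longleftrightarrow> P \<subseteq> S \<and> S \<subseteq> closure P"

end

theory Submission
  imports Defs
begin

text \<open>
  Every one of the ten conditions is tied to \<open>\<Gamma>\<close>-convergence, which is Kuratowski convergence of
  endographs.

  One direction is formal. An endograph is recovered from any dense family of its levels: a point
  \<open>(x, t)\<close> with \<open>t > 0\<close> lies in \<open>end u\<close> iff \<open>x\<close> lies in the level set at \<open>\<alpha>\<close> for all members
  \<open>\<alpha> < t\<close> of the family, and this passes to limits. So Kuratowski convergence of the levels on a
  dense set of heights implies \<open>\<Gamma>\<close>-convergence (\<open>Gamma_converges_of_dense_levels\<close>). Conditions that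
  hold almost everywhere, or on a dense subset of the non-platform heights, all provide such a dense
  set, because there are only countably many platform points: a platform height is the maximum of
  \<open>u\<close> over some member of a countable basis (\<open>countable_platform_points\<close>). The Hausdorff versions
  imply the Kuratowski versions since the limits are closed.

  The converse is where boundedness and star-shapedness enter. At a non-platform height \<open>\<alpha>\<close> the
  points \<open>y\<close> with \<open>u y > \<alpha>\<close> are dense in the level set \<open>A\<close> of \<open>u\<close>, and each of them is a limit of
  points in the level sets \<open>A\<^sub>n\<close> of \<open>us n\<close>; compactness of \<open>A\<close> makes this uniform. Conversely, the
  limit points of the \<open>A\<^sub>n\<close> lie in \<open>A\<close>, but a priori parts of \<open>A\<^sub>n\<close> could escape to infinity. They
  cannot: \<open>A\<^sub>n\<close> is connected, being star-shaped, and meets a small neighbourhood of \<open>A\<close>, so any far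
  away part would force it to cross the set of points at distance exactly \<open>e\<close> from \<open>A\<close>. That set is
  compact and contains no limit point of the \<open>A\<^sub>n\<close>, hence is eventually avoided
  (\<open>level_sets_Hausdorff_of_Gamma\<close>).

  Hausdorff convergence of the endographs follows in the same spirit
  (\<open>H_end_tendsto_0_of_Gamma\<close>): below a small height every point is close to the common floor
  \<open>t = 0\<close>, and above it everything takes place in one compact set, where Kuratowski convergence is
  uniform.
\<close>

section \<open>Hausdorff and Kuratowski convergence of sets\<close>

lemma infdist_lessE:
  assumes "infdist x A < e" "A \<noteq> {}"
  obtains a where "a \<in> A" "dist x a < e"
proof -
  have "\<exists>a\<in>A. dist x a < e"
  proof (rule ccontr)
    assume "\<not> ?thesis"
    then have "e \<le> infdist x A"
      unfolding infdist_notempty[OF assms(2)] using assms(2)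
      by (intro cINF_greatest) (auto simp: not_less)
    with assms show False by simp
  qed
  then show thesis using that by blast
qed

text \<open>This criterion removes the extended reals from all later arguments. It covers empty sets as
  well: an infimum over the empty set is infinite, in agreement with the failure of the existential
  statement.\<close>

lemma hausdorff_distance_tendsto_0_iff:
  fixes C :: "nat \<Rightarrow> 'a::metric_space set"
  shows "(\<lambda>n. hausdorff_distance (C n) L) \<longlonglongrightarrow> 0 \<longleftrightarrow>
    (\<forall>e>0. \<forall>\<^sub>F n in sequentially. (\<forall>a\<in>C n. \<exists>b\<in>L. dist a b < e) \<and> (\<forall>b\<in>L. \<exists>a\<in>C n. dist a b < e))"
    (is "?lim \<longleftrightarrow> (\<forall>e>0. eventually (?close e) sequentially)")
proof
  assume lim: ?lim
  show "\<forall>e>0. eventually (?close e) sequentially"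
  proof (intro allI impI)
    fix e :: real assume "e > 0"
    then have "\<forall>\<^sub>F n in sequentially. hausdorff_distance (C n) L < ennreal e"
      using order_tendstoD(2)[OF lim, of "ennreal e"] by simp
    then show "eventually (?close e) sequentially"
    proof eventually_elim
      case (elim n)
      have *: "(SUP a\<in>C n. INF b\<in>L. ennreal (dist a b)) < ennreal e"
        "(SUP b\<in>L. INF a\<in>C n. ennreal (dist a b)) < ennreal e"
        using elim by (auto simp: hausdorff_distance_def)
      show ?case
      proof (intro conjI ballI)
        fix a assume "a \<in> C n"
        then have "(INF b\<in>L. ennreal (dist a b)) < ennreal e"
          using *(1) by (meson SUP_upper order_le_less_trans)
        then show "\<exists>b\<in>L. dist a b < e"
          by (auto simp: INF_less_iff ennreal_less_iff)
      next
        fix b assume "b \<in> L"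
        then have "(INF a\<in>C n. ennreal (dist a b)) < ennreal e"
          using *(2) by (meson SUP_upper order_le_less_trans)
        then show "\<exists>a\<in>C n. dist a b < e"
          by (auto simp: INF_less_iff ennreal_less_iff)
      qed
    qed
  qed
next
  assume close: "\<forall>e>0. eventually (?close e) sequentially"
  show ?lim
  proof (rule order_tendstoI)
    fix y :: ennreal assume "0 < y"
    then obtain z where z: "0 < z" "z < y" using dense by blast
    obtain e where e: "z = ennreal e" "0 < e"
      using z by (cases z) auto
    have "eventually (?close e) sequentially" using close e by blast
    then show "\<forall>\<^sub>F n in sequentially. hausdorff_distance (C n) L < y"
    proof eventually_elim
      case (elim n)
      have "(SUP a\<in>C n. INF b\<in>L. ennreal (dist a b)) \<le> ennreal e"
      proof (rule SUP_least)
        fix a assume "a \<in> C n"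
        then obtain b where "b \<in> L" "dist a b < e" using elim by blast
        then show "(INF b\<in>L. ennreal (dist a b)) \<le> ennreal e"
          by (intro INF_lower2[of b]) (auto intro: ennreal_leI)
      qed
      moreover have "(SUP b\<in>L. INF a\<in>C n. ennreal (dist a b)) \<le> ennreal e"
      proof (rule SUP_least)
        fix b assume "b \<in> L"
        then obtain a where "a \<in> C n" "dist a b < e" using elim by blast
        then show "(INF a\<in>C n. ennreal (dist a b)) \<le> ennreal e"
          by (intro INF_lower2[of a]) (auto intro: ennreal_leI)
      qed
      ultimately have "hausdorff_distance (C n) L \<le> ennreal e"
        by (simp add: hausdorff_distance_def)
      then show ?case using z e by simp
    qed
  qed simp
qed

lemma mem_kuratowski_liminf_iff:
  fixes C :: "nat \<Rightarrow> 'a::metric_space set"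
  assumes ne: "\<And>n. C n \<noteq> {}"
  shows "x \<in> kuratowski_liminf C \<longleftrightarrow> (\<forall>e>0. \<forall>\<^sub>F n in sequentially. \<exists>a\<in>C n. dist a x < e)"
proof
  assume "x \<in> kuratowski_liminf C"
  then obtain xs where xs: "\<And>n. xs n \<in> C n" "xs \<longlonglongrightarrow> x"
    by (auto simp: kuratowski_liminf_def)
  show "\<forall>e>0. \<forall>\<^sub>F n in sequentially. \<exists>a\<in>C n. dist a x < e"
  proof (intro allI impI)
    fix e :: real assume "e > 0"
    then have "\<forall>\<^sub>F n in sequentially. dist (xs n) x < e"
      using xs(2) tendsto_iff by blast
    then show "\<forall>\<^sub>F n in sequentially. \<exists>a\<in>C n. dist a x < e"
      by eventually_elim (use xs(1) in blast)
  qed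
next
  assume near: "\<forall>e>0. \<forall>\<^sub>F n in sequentially. \<exists>a\<in>C n. dist a x < e"
  \<comment> \<open>The points chosen in \<open>C n\<close> nearly realise its distance from \<open>x\<close>.\<close>
  have "\<exists>a\<in>C n. dist x a < infdist x (C n) + inverse (real (Suc n))" for n
    using infdist_lessE[OF _ ne, of x n "infdist x (C n) + inverse (real (Suc n))"]
    by (smt (verit) inverse_positive_iff_positive of_nat_0_less_iff zero_less_Suc)
  then obtain xs where xs: "\<And>n. xs n \<in> C n"
    "\<And>n. dist x (xs n) < infdist x (C n) + inverse (real (Suc n))"
    by metis
  have "(\<lambda>n. infdist x (C n)) \<longlonglongrightarrow> 0"
    unfolding tendsto_iff
  proof (intro allI impI)
    fix e :: real assume "e > 0"
    then have "\<forall>\<^sub>F n in sequentially. \<exists>a\<in>C n. dist a x < e" using near by blast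
    then show "\<forall>\<^sub>F n in sequentially. dist (infdist x (C n)) 0 < e"
    proof eventually_elim
      case (elim n)
      then obtain a where "a \<in> C n" "dist x a < e" by (auto simp: dist_commute)
      then show ?case using infdist_le[of a "C n" x] by (simp add: infdist_nonneg)
    qed
  qed
  from tendsto_add[OF this LIMSEQ_inverse_real_of_nat]
  have lim: "(\<lambda>n. infdist x (C n) + inverse (real (Suc n))) \<longlonglongrightarrow> 0"
    by (simp only: add_0_left)
  have "\<forall>n. norm (dist (xs n) x) \<le> infdist x (C n) + inverse (real (Suc n))"
  proof
    show "norm (dist (xs n) x) \<le> infdist x (C n) + inverse (real (Suc n))" for n
      using xs(2)[of n] dist_commute[of x "xs n"] by (simp del: of_nat_Suc)
  qed
  from Lim_null_comparison[OF always_eventually[OF this] lim]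
  have "xs \<longlonglongrightarrow> x" by (rule iffD2[OF tendsto_dist_iff])
  with xs(1) show "x \<in> kuratowski_liminf C"
    by (auto simp: kuratowski_liminf_def)
qed

lemma kuratowski_convergesI:
  assumes "L \<subseteq> kuratowski_liminf C" "kuratowski_limsup C \<subseteq> L"
  shows "kuratowski_converges C L"
proof -
  have "kuratowski_liminf C \<subseteq> kuratowski_limsup C"
    unfolding kuratowski_liminf_def kuratowski_limsup_def
    using strict_mono_id by fastforce
  with assms show ?thesis unfolding kuratowski_converges_def by blast
qed

lemma kuratowski_converges_of_hausdorff:
  fixes C :: "nat \<Rightarrow> 'a::metric_space set"
  assumes ne: "\<And>n. C n \<noteq> {}" and L: "closed L"
    and lim: "(\<lambda>n. hausdorff_distance (C n) L) \<longlonglongrightarrow> 0"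
  shows "kuratowski_converges C L"
proof (rule kuratowski_convergesI)
  note close = lim[unfolded hausdorff_distance_tendsto_0_iff, rule_format]
  show "L \<subseteq> kuratowski_liminf C"
  proof
    fix x assume "x \<in> L"
    show "x \<in> kuratowski_liminf C"
      unfolding mem_kuratowski_liminf_iff[of C, OF ne]
    proof (intro allI impI)
      fix e :: real assume "e > 0"
      from close[OF this] show "\<forall>\<^sub>F n in sequentially. \<exists>a\<in>C n. dist a x < e"
        by eventually_elim (use \<open>x \<in> L\<close> in blast)
    qed
  qed
  show "kuratowski_limsup C \<subseteq> L"
  proof
    fix x assume "x \<in> kuratowski_limsup C"
    then obtain r xs where r: "strict_mono r" and xs: "\<And>j. xs j \<in> C (r j)" "xs \<longlonglongrightarrow> x"
      by (auto simp: kuratowski_limsup_def)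
    have "\<exists>b\<in>L. dist b x < e" if "e > 0" for e
    proof -
      have e2: "e / 2 > 0" using that by simp
      have "\<forall>\<^sub>F j in sequentially. \<forall>a\<in>C (r j). \<exists>b\<in>L. dist a b < e / 2"
        using eventually_subseq[OF r close[OF e2]] by eventually_elim blast
      moreover have "\<forall>\<^sub>F j in sequentially. dist (xs j) x < e / 2"
        using xs(2) e2 tendsto_iff by blast
      ultimately have "\<forall>\<^sub>F j in sequentially. \<exists>b\<in>L. dist b x < e"
      proof eventually_elim
        case (elim j)
        then obtain b where "b \<in> L" "dist (xs j) b < e / 2" using xs(1) by blast
        then show ?case using elim(2) dist_triangle_half_r[of "xs j" b e x] by blast
      qed
      then show ?thesis by (auto dest: eventually_happens)
    qed
    then have "x \<in> closure L" by (simp add: closure_approachable)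
    then show "x \<in> L" using L by simp
  qed
qed

text \<open>Pointwise approximation is uniform on compact sets: a finite net of limit points is
  approximated simultaneously. It is enough that the limit points are dense in the compact set;
  at a non-platform height only the points strictly above that height are known to be limits.\<close>

lemma kuratowski_liminf_uniform_on_compact:
  fixes C :: "nat \<Rightarrow> 'a::metric_space set"
  assumes ne: "\<And>n. C n \<noteq> {}" and K: "compact K" "K \<subseteq> closure (kuratowski_liminf C)"
    and e: "e > 0"
  shows "\<forall>\<^sub>F n in sequentially. \<forall>b\<in>K. \<exists>a\<in>C n. dist a b < e"
proof -
  have e2: "e / 2 > 0" using e by simp
  have "K \<subseteq> (\<Union>y\<in>kuratowski_liminf C. ball y (e / 2))"
  proof
    fix b assume "b \<in> K"
    then have "b \<in> closure (kuratowski_liminf C)" using K(2) by blast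
    then obtain y where "y \<in> kuratowski_liminf C" "dist y b < e / 2"
      using e2 unfolding closure_approachable by blast
    then show "b \<in> (\<Union>y\<in>kuratowski_liminf C. ball y (e / 2))" by auto
  qed
  then obtain D where D: "D \<subseteq> kuratowski_liminf C" "finite D" "K \<subseteq> (\<Union>y\<in>D. ball y (e / 2))"
    by (rule compactE_image[OF K(1) open_ball])
  have "\<forall>\<^sub>F n in sequentially. \<forall>y\<in>D. \<exists>a\<in>C n. dist a y < e / 2"
    using D(1,2) e2 mem_kuratowski_liminf_iff[of C, OF ne]
    by (intro eventually_ball_finite ballI) blast+
  then show ?thesis
  proof eventually_elim
    case (elim n)
    show ?case
    proof
      fix b assume "b \<in> K"
      then obtain y where y: "y \<in> D" "dist y b < e / 2" using D(3) by auto
      then obtain a where "a \<in> C n" "dist a y < e / 2" using elim by blast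
      then show "\<exists>a\<in>C n. dist a b < e"
        using y dist_triangle_half_l[of a y e b] by (auto simp: dist_commute)
    qed
  qed
qed

lemma eventually_avoids_compact:
  fixes C :: "nat \<Rightarrow> 'a::metric_space set"
  assumes K: "compact K" "kuratowski_limsup C \<inter> K = {}"
  shows "\<forall>\<^sub>F n in sequentially. C n \<inter> K = {}"
proof (rule ccontr)
  assume "\<not> ?thesis"
  then obtain r :: "nat \<Rightarrow> nat" where r: "strict_mono r" "\<And>j. C (r j) \<inter> K \<noteq> {}"
    using not_eventually_sequentiallyD by blast
  then have "\<exists>x. x \<in> C (r j) \<and> x \<in> K" for j by blast
  then obtain xs where xs: "\<And>j. xs j \<in> C (r j)" "\<And>j. xs j \<in> K" by metis
  obtain l s where l: "l \<in> K" "strict_mono s" "(xs \<circ> s) \<longlonglongrightarrow> l"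
    using K(1) xs(2) unfolding compact_def by metis
  have "l \<in> kuratowski_limsup C"
    unfolding kuratowski_limsup_def mem_Collect_eq
  proof (intro exI conjI allI)
    show "strict_mono (r \<circ> s)" using r(1) l(2) by (rule strict_mono_o)
    show "(xs \<circ> s) j \<in> C ((r \<circ> s) j)" for j using xs(1) by simp
  qed (rule l(3))
  with l(1) K(2) show False by blast
qed

section \<open>Levels and endographs of upper semicontinuous functions\<close>

lemma closed_level_set:
  assumes "upper_semicontinuous u"
  shows "closed (level_set u \<alpha>)"
proof -
  have "open {x. u x < \<alpha>}"
    unfolding open_subopen[of "{x. u x < \<alpha>}"]
  proof
    fix x assume "x \<in> {x. u x < \<alpha>}"
    then have "\<forall>\<^sub>F y in nhds x. u y < \<alpha>"
      using assms unfolding upper_semicontinuous_def by blast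
    then show "\<exists>T. open T \<and> x \<in> T \<and> T \<subseteq> {x. u x < \<alpha>}"
      unfolding eventually_nhds by blast
  qed
  moreover have "level_set u \<alpha> = - {x. u x < \<alpha>}" by (auto simp: level_set_def)
  ultimately show ?thesis by (simp add: closed_def)
qed

lemma closed_endograph:
  fixes u :: "'a::topological_space \<Rightarrow> real"
  assumes "upper_semicontinuous u"
  shows "closed (endograph u)"
proof -
  \<comment> \<open>Comparing \<open>t\<close> and \<open>u x\<close> with all intermediate heights \<open>c\<close> reduces closedness of the endograph
    to closedness of the level sets.\<close>
  have "endograph u = (\<Inter>c. level_set u c \<times> UNIV \<union> UNIV \<times> {..c}) \<inter> UNIV \<times> {0..1}"
  proof -
    have between: "t \<le> v \<longleftrightarrow> (\<forall>c. c \<le> v \<or> t \<le> c)" for t v :: real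
    proof (cases "t \<le> v")
      case True
      then show ?thesis by (metis linear order_trans)
    next
      case False
      then obtain c where "v < c" "c < t" using dense[of v t] by auto
      with False show ?thesis by (metis not_le)
    qed
    have "(x, t) \<in> endograph u \<longleftrightarrow>
        (x, t) \<in> (\<Inter>c. level_set u c \<times> UNIV \<union> UNIV \<times> {..c}) \<inter> UNIV \<times> {0..1}" for x t
      using between[of t "u x"] by (simp add: endograph_def level_set_def) argo
    then show ?thesis by auto
  qed
  then show ?thesis
    using closed_level_set[OF assms]
    by (auto intro!: closed_Int closed_INT closed_Un closed_Times)
qed

text \<open>A platform height is recovered from any basic open set around a point of the level set that
  is isolated from the strictly higher points: it is the maximum of the function there. Hence the
  members of a countable basis enumerate the platform points.\<close>

lemma countable_platform_points:
  fixes u :: "'a::second_countable_topology \<Rightarrow> real"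
  shows "countable (platform_points u)"
proof -
  obtain B :: "'a set set" where B: "countable B" "topological_basis B"
    using ex_countable_basis by blast
  have "platform_points u \<subseteq> (\<lambda>b. SUP y\<in>b. u y) ` B"
  proof
    fix \<alpha> assume "\<alpha> \<in> platform_points u"
    then obtain x where x: "\<alpha> \<le> u x" "x \<notin> closure (strict_level_set u \<alpha>)"
      by (auto simp: platform_points_def level_set_def)
    then obtain b where b: "b \<in> B" "x \<in> b" "b \<subseteq> - closure (strict_level_set u \<alpha>)"
      using topological_basisE[OF B(2), of "- closure (strict_level_set u \<alpha>)" x] by auto
    then have le: "u y \<le> \<alpha>" if "y \<in> b" for y
      using that closure_subset[of "strict_level_set u \<alpha>"] by (force simp: strict_level_set_def)
    have "(SUP y\<in>b. u y) = \<alpha>"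
      using le b(2) x(1) by (intro cSup_eq_maximum) (auto intro!: image_eqI[of _ u x] antisym)
    with b show "\<alpha> \<in> (\<lambda>b. SUP y\<in>b. u y) ` B" by blast
  qed
  with B show ?thesis by (meson countable_image countable_subset)
qed

lemma fuzzy_star_ncD:
  assumes "u \<in> fuzzy_star_nc"
  shows "fuzzy_set u" "upper_semicontinuous u"
    and "0 < \<alpha> \<Longrightarrow> \<alpha> \<le> 1 \<Longrightarrow> compact (level_set u \<alpha>)"
    and "0 < \<alpha> \<Longrightarrow> \<alpha> \<le> 1 \<Longrightarrow> connected (level_set u \<alpha>)"
    and "\<alpha> \<le> 1 \<Longrightarrow> level_set u \<alpha> \<noteq> {}"
  using assms closed_level_set[of u]
  by (auto simp: fuzzy_star_nc_def compact_eq_bounded_closed starlike_imp_connected)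
    (metis (mono_tags) empty_iff level_set_def mem_Collect_eq)

lemma endograph_nonempty: "fuzzy_set u \<Longrightarrow> endograph u \<noteq> {}"
  unfolding endograph_def fuzzy_set_def by (auto intro!: exI[of _ 0])

section \<open>Dense sets of heights\<close>

lemma dense_between:
  fixes D :: "real set"
  assumes "{0<..<1} \<subseteq> closure D" "0 \<le> a" "a < b" "b \<le> 1"
  obtains \<alpha> where "\<alpha> \<in> D" "a < \<alpha>" "\<alpha> < b"
proof -
  have "(a + b) / 2 \<in> {a<..<b} \<inter> closure D" using assms by auto
  then have "{a<..<b} \<inter> D \<noteq> {}"
    using open_Int_closure_eq_empty[OF open_greaterThanLessThan, of a b D] by blast
  with that show thesis by auto
qed

lemma AE_imp_dense:
  assumes "AE \<alpha> in lebesgue. \<alpha> \<in> {0<..<1::real} \<longrightarrow> Q \<alpha>"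
  shows "{0<..<1} \<subseteq> closure {\<alpha>\<in>{0<..<1}. Q \<alpha>}"
proof -
  let ?D = "{\<alpha>\<in>{0<..<1}. Q \<alpha>}"
  let ?G = "{0<..<1} - closure ?D"
  have op: "open ?G" by auto
  have "AE \<alpha> in lebesgue. \<alpha> \<notin> ?G"
    using assms by eventually_elim (use closure_subset[of ?D] in auto)
  then have "?G \<in> null_sets lebesgue"
    using op by (subst AE_iff_null_sets) auto
  then have "?G = {}"
    using op open_not_negligible negligible_iff_null_sets by blast
  then show ?thesis by blast
qed

lemma AE_not_platform_point:
  fixes u :: "'a::second_countable_topology \<Rightarrow> real"
  shows "AE \<alpha> in lebesgue. \<alpha> \<notin> platform_points u"
  by (intro AE_completion AE_not_in countable_imp_null_set_lborel countable_platform_points)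

lemma non_platform_dense:
  fixes u :: "'a::second_countable_topology \<Rightarrow> real"
  shows "{0<..<1} \<subseteq> closure ({0<..<1} - platform_points u)"
proof -
  have "AE \<alpha> in lebesgue. \<alpha> \<in> {0<..<1::real} \<longrightarrow> \<alpha> \<notin> platform_points u"
    using AE_not_platform_point[of u] by eventually_elim simp
  from AE_imp_dense[OF this] show ?thesis by (simp add: set_diff_eq)
qed

section \<open>Gamma-convergence and convergence of levels\<close>

lemma Gamma_converges_of_dense_levels:
  fixes u :: "'a::metric_space \<Rightarrow> real"
  assumes fz: "fuzzy_set u" "\<And>n. fuzzy_set (us n)" and D: "{0<..<1} \<subseteq> closure D"
    and conv: "\<And>\<alpha>. \<alpha> \<in> D \<Longrightarrow> kuratowski_converges (\<lambda>n. level_set (us n) \<alpha>) (level_set u \<alpha>)"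
  shows "Gamma_converges us u"
  unfolding Gamma_converges_def
proof (rule kuratowski_convergesI)
  show "endograph u \<subseteq> kuratowski_liminf (\<lambda>n. endograph (us n))"
  proof
    fix p assume "p \<in> endograph u"
    then obtain x t where p: "p = (x, t)" "0 \<le> t" "t \<le> 1" "t \<le> u x"
      by (auto simp: endograph_def)
    show "p \<in> kuratowski_liminf (\<lambda>n. endograph (us n))"
    proof (cases "t = 0")
      case True
      then show ?thesis
        using p fz by (auto simp: kuratowski_liminf_def endograph_def fuzzy_set_def
            intro!: exI[of _ "\<lambda>_. p"])
    next
      case False
      show ?thesis
        unfolding mem_kuratowski_liminf_iff[of "\<lambda>n. endograph (us n)", OF endograph_nonempty[OF fz(2)]]
      proof (intro allI impI)
        fix e :: real assume e: "e > 0"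
        \<comment> \<open>Lower the height slightly, by at most \<open>e / 2\<close>, to meet \<open>D\<close>.\<close>
        obtain \<alpha> where \<alpha>: "\<alpha> \<in> D" "max 0 (t - e / 2) < \<alpha>" "\<alpha> < t"
          using dense_between[OF D, of "max 0 (t - e / 2)" t] p False e by auto
        have "x \<in> kuratowski_liminf (\<lambda>n. level_set (us n) \<alpha>)"
          using conv[OF \<alpha>(1)] p \<alpha> by (auto simp: kuratowski_converges_def level_set_def)
        then obtain xs where xs: "\<And>n. xs n \<in> level_set (us n) \<alpha>" "xs \<longlonglongrightarrow> x"
          by (auto simp: kuratowski_liminf_def)
        then have "\<forall>\<^sub>F n in sequentially. dist (xs n) x < e / 2"
          using e tendsto_iff by (metis half_gt_zero)
        then show "\<forall>\<^sub>F n in sequentially. \<exists>a\<in>endograph (us n). dist a p < e"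
        proof eventually_elim
          case (elim n)
          have "dist (xs n, \<alpha>) p \<le> dist (xs n) x + dist \<alpha> t"
            unfolding p(1) dist_Pair_Pair by (rule sqrt_sum_squares_le_sum) auto
          also have "\<dots> < e" using elim \<alpha> by (auto simp: dist_real_def)
          finally show ?case
            using xs(1)[of n] \<alpha> p
            by (intro bexI[of _ "(xs n, \<alpha>)"]) (auto simp: endograph_def level_set_def)
        qed
      qed
    qed
  qed
  show "kuratowski_limsup (\<lambda>n. endograph (us n)) \<subseteq> endograph u"
  proof
    fix p assume "p \<in> kuratowski_limsup (\<lambda>n. endograph (us n))"
    then obtain r ps where r: "strict_mono r" and ps: "\<And>j. ps j \<in> endograph (us (r j))" "ps \<longlonglongrightarrow> p"
      by (auto simp: kuratowski_limsup_def)
    define x t where "x = fst p" and "t = snd p"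
    have xlim: "(\<lambda>j. fst (ps j)) \<longlonglongrightarrow> x" and tlim: "(\<lambda>j. snd (ps j)) \<longlonglongrightarrow> t"
      using ps(2) by (auto simp: x_def t_def intro: tendsto_fst tendsto_snd)
    have ps': "0 \<le> snd (ps j)" "snd (ps j) \<le> 1" "snd (ps j) \<le> us (r j) (fst (ps j))" for j
      using ps(1)[of j] by (auto simp: endograph_def)
    have t: "0 \<le> t" "t \<le> 1"
      using LIMSEQ_le_const[OF tlim] LIMSEQ_le_const2[OF tlim] ps' by auto
    have "t \<le> u x"
    proof (rule ccontr)
      assume "\<not> t \<le> u x"
      then obtain \<alpha> where \<alpha>: "\<alpha> \<in> D" "u x < \<alpha>" "\<alpha> < t"
        using dense_between[OF D, of "u x" t] fz(1) t by (auto simp: fuzzy_set_def)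
      obtain N where N: "\<And>j. j \<ge> N \<Longrightarrow> \<alpha> < snd (ps j)"
        using order_tendstoD(1)[OF tlim \<alpha>(3)] by (auto simp: eventually_sequentially)
      have "x \<in> kuratowski_limsup (\<lambda>n. level_set (us n) \<alpha>)"
        unfolding kuratowski_limsup_def mem_Collect_eq
      proof (intro exI conjI allI)
        show "strict_mono (\<lambda>j. r (j + N))"
          using r by (auto simp: strict_mono_def)
        show "fst (ps (j + N)) \<in> level_set (us (r (j + N))) \<alpha>" for j
          using N[of "j + N"] ps'(3)[of "j + N"] by (auto simp: level_set_def)
        show "(\<lambda>j. fst (ps (j + N))) \<longlonglongrightarrow> x"
          using xlim by (rule LIMSEQ_ignore_initial_segment)
      qed
      then have "x \<in> level_set u \<alpha>"
        using conv[OF \<alpha>(1)] by (auto simp: kuratowski_converges_def)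
      then show False using \<alpha> by (auto simp: level_set_def)
    qed
    then have "(x, t) \<in> endograph u" using t by (simp add: endograph_def)
    then show "p \<in> endograph u" by (simp add: x_def t_def)
  qed
qed

lemma strict_level_set_subset_liminf:
  fixes u :: "'a::metric_space \<Rightarrow> real"
  assumes G: "Gamma_converges us u" and \<alpha>: "0 \<le> \<alpha>"
    and fz: "fuzzy_set u" and ne: "\<And>n. level_set (us n) \<alpha> \<noteq> {}"
  shows "strict_level_set u \<alpha> \<subseteq> kuratowski_liminf (\<lambda>n. level_set (us n) \<alpha>)"
proof
  fix y assume y: "y \<in> strict_level_set u \<alpha>"
  then have "(y, u y) \<in> endograph u"
    using fz by (auto simp: endograph_def fuzzy_set_def)
  then obtain ps where ps: "\<And>n. ps n \<in> endograph (us n)" "ps \<longlonglongrightarrow> (y, u y)"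
    using G by (auto simp: Gamma_converges_def kuratowski_converges_def kuratowski_liminf_def)
  have ylim: "(\<lambda>n. fst (ps n)) \<longlonglongrightarrow> y" and tlim: "(\<lambda>n. snd (ps n)) \<longlonglongrightarrow> u y"
    using tendsto_fst[OF ps(2)] tendsto_snd[OF ps(2)] by auto
  have "\<alpha> < u y" using y by (simp add: strict_level_set_def)
  note ev = order_tendstoD(1)[OF tlim this]
  show "y \<in> kuratowski_liminf (\<lambda>n. level_set (us n) \<alpha>)"
    unfolding mem_kuratowski_liminf_iff[of "\<lambda>n. level_set (us n) \<alpha>", OF ne]
  proof (intro allI impI)
    fix e :: real assume "e > 0"
    then have "\<forall>\<^sub>F n in sequentially. dist (fst (ps n)) y < e"
      by (rule tendstoD[OF ylim])
    with ev show "\<forall>\<^sub>F n in sequentially. \<exists>a\<in>level_set (us n) \<alpha>. dist a y < e"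
    proof eventually_elim
      case (elim n)
      then show ?case using ps(1)[of n]
        by (intro bexI[of _ "fst (ps n)"]) (auto simp: endograph_def level_set_def)
    qed
  qed
qed

lemma limsup_level_sets_subset:
  fixes u :: "'a::metric_space \<Rightarrow> real"
  assumes G: "Gamma_converges us u" and \<alpha>: "0 \<le> \<alpha>" "\<alpha> \<le> 1"
  shows "kuratowski_limsup (\<lambda>n. level_set (us n) \<alpha>) \<subseteq> level_set u \<alpha>"
proof
  fix x assume "x \<in> kuratowski_limsup (\<lambda>n. level_set (us n) \<alpha>)"
  then obtain r xs where r: "strict_mono r"
    and xs: "\<And>j. xs j \<in> level_set (us (r j)) \<alpha>" "xs \<longlonglongrightarrow> x"
    by (auto simp: kuratowski_limsup_def)
  have "(x, \<alpha>) \<in> kuratowski_limsup (\<lambda>n. endograph (us n))"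
    unfolding kuratowski_limsup_def mem_Collect_eq
  proof (intro exI conjI allI)
    show "(xs j, \<alpha>) \<in> endograph (us (r j))" for j
      using xs(1)[of j] \<alpha> by (auto simp: endograph_def level_set_def)
    show "(\<lambda>j. (xs j, \<alpha>)) \<longlonglongrightarrow> (x, \<alpha>)"
      using xs(2) by (intro tendsto_Pair) auto
  qed (rule r)
  then show "x \<in> level_set u \<alpha>"
    using G by (auto simp: Gamma_converges_def kuratowski_converges_def endograph_def level_set_def)
qed

text \<open>The upper half of the Hausdorff estimate is the heart of the theorem. Without connectedness
  it fails: level sets with an isolated point running off to infinity \<open>\<Gamma>\<close>-converge without
  converging in the Hausdorff metric.\<close>

lemma level_sets_Hausdorff_of_Gamma:
  fixes u :: "'a::heine_borel \<Rightarrow> real"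
  assumes G: "Gamma_converges us u" and \<alpha>: "\<alpha> \<in> {0<..<1} - platform_points u"
    and fz: "fuzzy_set u"
    and A: "compact (level_set u \<alpha>)" "level_set u \<alpha> \<noteq> {}"
    and An: "\<And>n. connected (level_set (us n) \<alpha>)" "\<And>n. level_set (us n) \<alpha> \<noteq> {}"
  shows "(\<lambda>n. hausdorff_distance (level_set (us n) \<alpha>) (level_set u \<alpha>)) \<longlonglongrightarrow> 0"
  unfolding hausdorff_distance_tendsto_0_iff
proof (intro allI impI)
  fix e :: real assume e: "e > 0"
  let ?A = "level_set u \<alpha>" and ?C = "\<lambda>n. level_set (us n) \<alpha>"
  have "closure (strict_level_set u \<alpha>) \<subseteq> ?A"
    using compact_imp_closed[OF A(1)] by (intro closure_minimal) (auto simp: strict_level_set_def level_set_def)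
  then have "?A \<subseteq> closure (strict_level_set u \<alpha>)"
    using \<alpha> by (auto simp: platform_points_def)
  also have "\<dots> \<subseteq> closure (kuratowski_liminf ?C)"
    using \<alpha> by (intro closure_mono strict_level_set_subset_liminf[of us u \<alpha>, OF G _ fz An(2)]) auto
  finally have lower: "\<forall>\<^sub>F n in sequentially. \<forall>b\<in>?A. \<exists>a\<in>?C n. dist a b < e"
    by (rule kuratowski_liminf_uniform_on_compact[of ?C, OF An(2) A(1) _ e])
  let ?S = "{x. infdist x ?A = e}"
  have "?S = {x. infdist x ?A \<le> e} \<inter> {x. e \<le> infdist x ?A}" by auto
  then have "compact ?S"
    using compact_infdist_le[OF A(2,1) e]
    by (auto intro!: compact_Int_closed closed_Collect_le continuous_intros)
  moreover have "kuratowski_limsup ?C \<inter> ?S = {}"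
    using limsup_level_sets_subset[OF G, of \<alpha>] \<alpha> e by auto
  ultimately have "\<forall>\<^sub>F n in sequentially. ?C n \<inter> ?S = {}"
    by (rule eventually_avoids_compact)
  with lower show "\<forall>\<^sub>F n in sequentially.
      (\<forall>a\<in>?C n. \<exists>b\<in>?A. dist a b < e) \<and> (\<forall>b\<in>?A. \<exists>a\<in>?C n. dist a b < e)"
  proof eventually_elim
    case (elim n)
    obtain b where b: "b \<in> ?A" using A(2) by blast
    then obtain c where c: "c \<in> ?C n" "dist c b < e" using elim(1) by blast
    then have cl: "infdist c ?A < e" using infdist_le[OF b, of c] by simp
    have "infdist a ?A < e" if a: "a \<in> ?C n" for a
    proof (rule ccontr)
      assume "\<not> ?thesis"
      \<comment> \<open>The distance from \<open>?A\<close> takes on \<open>?C n\<close> values on both sides of \<open>e\<close>, hence also \<open>e\<close>.\<close>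
      moreover have "connected ((\<lambda>x. infdist x ?A) ` ?C n)"
        using An(1) by (intro connected_continuous_image continuous_intros)
      ultimately have "e \<in> (\<lambda>x. infdist x ?A) ` ?C n"
        using connectedD_interval[of "(\<lambda>x. infdist x ?A) ` ?C n" "infdist c ?A" "infdist a ?A" e]
          a c(1) cl by auto
      with elim(2) show False by blast
    qed
    then have "\<forall>a\<in>?C n. \<exists>b\<in>?A. dist a b < e"
      using infdist_lessE[OF _ A(2)] by metis
    with elim(1) show ?case by blast
  qed
qed

lemma H_end_tendsto_0_of_Gamma:
  fixes u :: "'a::heine_borel \<Rightarrow> real"
  assumes G: "Gamma_converges us u" and fz: "fuzzy_set u" "\<And>n. fuzzy_set (us n)"
    and usc: "upper_semicontinuous u"
    and small: "\<And>e. e > 0 \<Longrightarrow> \<exists>\<alpha>. 0 < \<alpha> \<and> \<alpha> < e \<and> compact (level_set u \<alpha>) \<and> level_set u \<alpha> \<noteq> {} \<and>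
      (\<lambda>n. hausdorff_distance (level_set (us n) \<alpha>) (level_set u \<alpha>)) \<longlonglongrightarrow> 0"
  shows "(\<lambda>n. H_end (us n) u) \<longlonglongrightarrow> 0"
  unfolding H_end_def hausdorff_distance_tendsto_0_iff
proof (intro allI impI)
  fix e :: real assume e: "e > 0"
  let ?E = "endograph u" and ?En = "\<lambda>n. endograph (us n)"
  have K: "kuratowski_liminf ?En = ?E" "kuratowski_limsup ?En = ?E"
    using G by (auto simp: Gamma_converges_def kuratowski_converges_def)
  have cl: "closed ?E" using closed_endograph[OF usc] .
  obtain \<alpha> where \<alpha>: "0 < \<alpha>" "\<alpha> < e" "compact (level_set u \<alpha>)" "level_set u \<alpha> \<noteq> {}"
    and lim: "(\<lambda>n. hausdorff_distance (level_set (us n) \<alpha>) (level_set u \<alpha>)) \<longlonglongrightarrow> 0"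
    using small[OF e] by blast
  have floor: "(x, 0) \<in> ?E" "(x, 0) \<in> ?En n" for x n
    using fz by (auto simp: endograph_def fuzzy_set_def)
  \<comment> \<open>All levels at height \<open>\<alpha>\<close> are eventually within distance \<open>1\<close> of that of \<open>u\<close>, which bounds the
    part of the endographs above \<open>\<alpha>\<close>.\<close>
  let ?K = "({x. infdist x (level_set u \<alpha>) \<le> 1} \<times> {0..1}) \<inter> {p. e \<le> infdist p ?E}"
  have "\<forall>\<^sub>F n in sequentially. \<forall>a\<in>level_set (us n) \<alpha>. \<exists>b\<in>level_set u \<alpha>. dist a b < 1"
    using lim[unfolded hausdorff_distance_tendsto_0_iff, rule_format, of 1]
    by (auto elim: eventually_mono)
  then have bnd: "\<forall>\<^sub>F n in sequentially. \<forall>a\<in>level_set (us n) \<alpha>. infdist a (level_set u \<alpha>) \<le> 1"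
    by eventually_elim (meson infdist_le2 less_imp_le)
  have "compact ?K"
    using compact_infdist_le[OF \<alpha>(4,3), of 1]
    by (auto intro!: compact_Int_closed compact_Times closed_Collect_le continuous_intros)
  moreover have "kuratowski_limsup ?En \<inter> ?K = {}"
    using e by (auto simp: K)
  ultimately have upper: "\<forall>\<^sub>F n in sequentially. ?En n \<inter> ?K = {}"
    by (rule eventually_avoids_compact)
  let ?L = "(level_set u \<alpha> \<times> {0..1}) \<inter> ?E"
  have "compact ?L"
    using \<alpha>(3) cl by (intro compact_Int_closed compact_Times) auto
  moreover have "?L \<subseteq> closure (kuratowski_liminf ?En)"
    using closure_subset[of ?E] by (auto simp: K)
  ultimately have lower: "\<forall>\<^sub>F n in sequentially. \<forall>b\<in>?L. \<exists>a\<in>?En n. dist a b < e"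
    using endograph_nonempty[OF fz(2)] e
    by (intro kuratowski_liminf_uniform_on_compact) auto
  from bnd upper lower
  show "\<forall>\<^sub>F n in sequentially.
      (\<forall>a\<in>?En n. \<exists>b\<in>?E. dist a b < e) \<and> (\<forall>b\<in>?E. \<exists>a\<in>?En n. dist a b < e)"
  proof eventually_elim
    case (elim n)
    show ?case
    proof (intro conjI ballI)
      fix p assume p: "p \<in> ?En n"
      obtain x t where xt: "p = (x, t)" by (cases p)
      with p have t: "0 \<le> t" "t \<le> 1" "t \<le> us n x" by (auto simp: endograph_def)
      show "\<exists>b\<in>?E. dist p b < e"
      proof (cases "\<alpha> \<le> t")
        case True
        then have "infdist x (level_set u \<alpha>) \<le> 1"
          using elim(1) t by (auto simp: level_set_def)
        then have "infdist p ?E < e" using elim(2) p xt t by fastforce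
        then show ?thesis using infdist_lessE[OF _ endograph_nonempty[OF fz(1)]] by metis
      next
        case False
        then show ?thesis using floor(1)[of x] xt t \<alpha>
          by (intro bexI[of _ "(x, 0)"]) (auto simp: dist_Pair_Pair)
      qed
    next
      fix p assume p: "p \<in> ?E"
      obtain x t where xt: "p = (x, t)" by (cases p)
      with p have t: "0 \<le> t" "t \<le> 1" "t \<le> u x" by (auto simp: endograph_def)
      show "\<exists>a\<in>?En n. dist a p < e"
      proof (cases "\<alpha> \<le> t")
        case True
        then have "p \<in> ?L" using p xt t by (auto simp: level_set_def)
        then show ?thesis using elim(3) by blast
      next
        case False
        then show ?thesis using floor(2)[of x n] xt t \<alpha>
          by (intro bexI[of _ "(x, 0)"]) (auto simp: dist_Pair_Pair)
      qed
    qed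
  qed
qed

section \<open>The equivalence\<close>

theorem theorem9p4:
  fixes u :: "real ^ 'm \<Rightarrow> real" and us :: "nat \<Rightarrow> real ^ 'm \<Rightarrow> real"
  assumes "u \<in> fuzzy_star_nc" and "\<And>n. us n \<in> fuzzy_star_nc"
  shows
    "(((\<lambda>n. H_end (us n) u) \<longlonglongrightarrow> 0) \<longleftrightarrow>
       (AE \<alpha> in lebesgue. \<alpha> \<in> {0<..<1} \<longrightarrow> ((\<lambda>n. hausdorff_distance (level_set (us n) \<alpha>) (level_set u \<alpha>)) \<longlonglongrightarrow> 0))) \<and>
     (((\<lambda>n. H_end (us n) u) \<longlonglongrightarrow> 0) \<longleftrightarrow>
       (\<forall>\<alpha>\<in>{0<..<1} - platform_points u. ((\<lambda>n. hausdorff_distance (level_set (us n) \<alpha>) (level_set u \<alpha>)) \<longlonglongrightarrow> 0))) \<and>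
     (((\<lambda>n. H_end (us n) u) \<longlonglongrightarrow> 0) \<longleftrightarrow>
       (\<exists>P. dense_subset P ({0<..<1} - platform_points u) \<and> (\<forall>\<alpha>\<in>P. ((\<lambda>n. hausdorff_distance (level_set (us n) \<alpha>) (level_set u \<alpha>)) \<longlonglongrightarrow> 0)))) \<and>
     (((\<lambda>n. H_end (us n) u) \<longlonglongrightarrow> 0) \<longleftrightarrow>
       (\<exists>P. countable P \<and> dense_subset P ({0<..<1} - platform_points u) \<and> (\<forall>\<alpha>\<in>P. ((\<lambda>n. hausdorff_distance (level_set (us n) \<alpha>) (level_set u \<alpha>)) \<longlonglongrightarrow> 0)))) \<and>
     (((\<lambda>n. H_end (us n) u) \<longlonglongrightarrow> 0) \<longleftrightarrow>
       Gamma_converges us u) \<and>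
     (((\<lambda>n. H_end (us n) u) \<longlonglongrightarrow> 0) \<longleftrightarrow>
       (\<forall>\<alpha>\<in>{0<..<1} - platform_points u. kuratowski_converges (\<lambda>n. level_set (us n) \<alpha>) (level_set u \<alpha>))) \<and>
     (((\<lambda>n. H_end (us n) u) \<longlonglongrightarrow> 0) \<longleftrightarrow>
       (AE \<alpha> in lebesgue. \<alpha> \<in> {0<..<1} \<longrightarrow> kuratowski_converges (\<lambda>n. level_set (us n) \<alpha>) (level_set u \<alpha>))) \<and>
     (((\<lambda>n. H_end (us n) u) \<longlonglongrightarrow> 0) \<longleftrightarrow>
       (\<exists>P. dense_subset P ({0<..<1} - platform_points u) \<and> (\<forall>\<alpha>\<in>P. kuratowski_converges (\<lambda>n. level_set (us n) \<alpha>) (level_set u \<alpha>)))) \<and>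
     (((\<lambda>n. H_end (us n) u) \<longlonglongrightarrow> 0) \<longleftrightarrow>
       (\<exists>P. countable P \<and> dense_subset P ({0<..<1} - platform_points u) \<and> (\<forall>\<alpha>\<in>P. kuratowski_converges (\<lambda>n. level_set (us n) \<alpha>) (level_set u \<alpha>))))"
proof -
  note u = fuzzy_star_ncD[OF assms(1)] and us = fuzzy_star_ncD[OF assms(2)]
  let ?N = "{0<..<1} - platform_points u"
  let ?H = "\<lambda>\<alpha>. (\<lambda>n. hausdorff_distance (level_set (us n) \<alpha>) (level_set u \<alpha>)) \<longlonglongrightarrow> 0"
  let ?K = "\<lambda>\<alpha>. kuratowski_converges (\<lambda>n. level_set (us n) \<alpha>) (level_set u \<alpha>)"
  let ?E = "(\<lambda>n. H_end (us n) u) \<longlonglongrightarrow> 0"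
  let ?G = "Gamma_converges us u"

  have E_G: ?G if ?E
    using that unfolding Gamma_converges_def H_end_def
    by (intro kuratowski_converges_of_hausdorff endograph_nonempty closed_endograph u us)
  have G_H: "\<forall>\<alpha>\<in>?N. ?H \<alpha>" if ?G
    using that by (intro ballI level_sets_Hausdorff_of_Gamma u us) auto
  have G_E: ?E if ?G
  proof (rule H_end_tendsto_0_of_Gamma[OF that u(1) us(1) u(2)])
    fix e :: real assume "e > 0"
    then obtain \<alpha> where "\<alpha> \<in> ?N" "0 < \<alpha>" "\<alpha> < min e 1"
      using dense_between[OF non_platform_dense[of u], of 0 "min e 1"] by auto
    then show "\<exists>\<alpha>. 0 < \<alpha> \<and> \<alpha> < e \<and> compact (level_set u \<alpha>) \<and> level_set u \<alpha> \<noteq> {} \<and> ?H \<alpha>"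
      using G_H[OF that] u(3,5) by (intro exI[of _ \<alpha>]) auto
  qed
  have H_K: "?K \<alpha>" if "?H \<alpha>" "\<alpha> \<in> {0<..<1}" for \<alpha>
    using that by (intro kuratowski_converges_of_hausdorff us closed_level_set u) auto
  have dense_G: ?G if "{0<..<1} \<subseteq> closure D" "\<And>\<alpha>. \<alpha> \<in> D \<Longrightarrow> ?K \<alpha>" for D
    using that by (intro Gamma_converges_of_dense_levels u us) auto

  \<comment> \<open>Each condition on the levels follows from convergence at all non-platform heights, and implies
    Kuratowski convergence on a dense set of heights.\<close>
  have AE: "AE \<alpha> in lebesgue. \<alpha> \<in> {0<..<1} \<longrightarrow> Q \<alpha>" if "\<forall>\<alpha>\<in>?N. Q \<alpha>" for Q
    using AE_not_platform_point[of u] by eventually_elim (use that in blast)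
  obtain P0 where P0: "countable P0" "dense_subset P0 ?N"
    using separable[of ?N] unfolding dense_subset_def by metis
  have AE_G: ?G if "AE \<alpha> in lebesgue. \<alpha> \<in> {0<..<1} \<longrightarrow> ?K \<alpha>"
    by (rule dense_G[OF AE_imp_dense[OF that]]) auto
  have P_G: ?G if "dense_subset P ?N" "\<forall>\<alpha>\<in>P. ?K \<alpha>" for P
  proof (rule dense_G)
    have "closure ?N \<subseteq> closure P"
      using that(1) by (intro closure_minimal) (auto simp: dense_subset_def)
    then show "{0<..<1} \<subseteq> closure P" using non_platform_dense[of u] by blast
  qed (use that in blast)

  have vi: "?E \<longleftrightarrow> ?G" using E_G G_E by blast
  have G_K: "\<forall>\<alpha>\<in>?N. ?K \<alpha>" if ?G using G_H[OF that] H_K by blast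
  have viii: "?G \<longleftrightarrow> (AE \<alpha> in lebesgue. \<alpha> \<in> {0<..<1} \<longrightarrow> ?K \<alpha>)"
    using AE[OF G_K] AE_G by blast
  have ii: "?G \<longleftrightarrow> (AE \<alpha> in lebesgue. \<alpha> \<in> {0<..<1} \<longrightarrow> ?H \<alpha>)"
  proof
    assume "AE \<alpha> in lebesgue. \<alpha> \<in> {0<..<1} \<longrightarrow> ?H \<alpha>"
    then have "AE \<alpha> in lebesgue. \<alpha> \<in> {0<..<1} \<longrightarrow> ?K \<alpha>"
      by eventually_elim (use H_K in blast)
    then show ?G by (rule AE_G)
  qed (rule AE[OF G_H])
  have x: "?G \<longleftrightarrow> (\<exists>P. countable P \<and> dense_subset P ?N \<and> (\<forall>\<alpha>\<in>P. ?K \<alpha>))"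
    and ix: "?G \<longleftrightarrow> (\<exists>P. dense_subset P ?N \<and> (\<forall>\<alpha>\<in>P. ?K \<alpha>))"
    and vii: "?G \<longleftrightarrow> (\<forall>\<alpha>\<in>?N. ?K \<alpha>)"
    using P0 G_K P_G unfolding dense_subset_def by blast+
  have P_HK: "\<forall>\<alpha>\<in>P. ?K \<alpha>" if "dense_subset P ?N" "\<forall>\<alpha>\<in>P. ?H \<alpha>" for P
    using that H_K unfolding dense_subset_def by blast
  have N: "dense_subset ?N ?N" and P0N: "P0 \<subseteq> ?N"
    using P0(2) closure_subset unfolding dense_subset_def by blast+
  have iii: "?G \<longleftrightarrow> (\<forall>\<alpha>\<in>?N. ?H \<alpha>)"
    using G_H P_G[OF N P_HK[OF N]] by blast
  have P_HG: ?G if "dense_subset P ?N" "\<forall>\<alpha>\<in>P. ?H \<alpha>" for P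
    using P_G[OF that(1) P_HK[OF that]] .
  have P0_H: "\<forall>\<alpha>\<in>P0. ?H \<alpha>" if ?G
    using G_H[OF that] P0N by blast
  have v: "?G \<longleftrightarrow> (\<exists>P. countable P \<and> dense_subset P ?N \<and> (\<forall>\<alpha>\<in>P. ?H \<alpha>))"
    and iv: "?G \<longleftrightarrow> (\<exists>P. dense_subset P ?N \<and> (\<forall>\<alpha>\<in>P. ?H \<alpha>))"
    using P0 P0_H P_HG by blast+
  show ?thesis
    unfolding vi using ii iii iv v vii viii ix x by (intro conjI) (rule refl | assumption)+
qed

end
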